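(* Let $\theta_0=(\mathbf{A},\mathbf{b},\rho_w)\in\Theta$ be the true parameter of the BAR process $\{\mathbf{X}(k)\}_{k\ge 0}$ with positive correlations only, with arbitrary initial distribution. Then the closed-form estimator $\hat\theta$ defined in the context, computed from the observed sequence $\{\mathbf{x}(k)\}_{k=0}^{T}$ (including, in the special case where all $\rho_{w_i}$ are equal, the version in which $\hat{\mathbf{c}}$ is replaced by its averaged form), is strongly consistent, i.e., $\hat\theta\to\theta_0$ almost surely as $T\to\infty$.
   Context: Fix $p\in\mathbb{N}$ and constants $b_{min}\in(0,1)$ and $0<\rho_{min}<\rho_{max}<1$. Let $\mathbf{1}_n$ and $\mathbf{0}_n$ be the all-ones and all-zeros vectors of length $n$, $[p]=\{1,\dots,p\}$, and $\mathbb{I}(\cdot)$ the indicator. Parameter space: $\Theta$ is the compact set of triples $\theta=(\mathbf{A},\mathbf{b},\rho_w)$ with $\mathbf{A}=(a_{ij})\in[0,1]^{p\times p}$, $\mathbf{b}\in[0,1]^p$, $\rho_w\in\mathbb{R}^p$ such that for all $i\in[p]$: $\sum_{j=1}^p a_{ij}+b_i=1$, $b_i\ge b_{min}$, and $\rho_{w_i}\in[\rho_{min},\rho_{max}]$. The $i$-th row of $\mathbf{A}$ is denoted $\mathbf{a}_i^\top$. (The underlying directed graph on the nodes $[p]$ has an edge from $j$ to $i$ if and only if $a_{ij}>0$.) BAR model with positive correlations only, with parameter $\theta\in\Theta$: the Markov chain $\{\mathbf{X}(k)\}_{k\ge0}$ on $\{0,1\}^p$ with $$X_i(k+1)\sim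 \mathrm{Ber}\left(\mathbf{a}_i^\top\mathbf{X}(k)+b_iW_i(k+1)\right),\quad i=1,\dots,p,$$ where $W_i(k+1)\sim\mathrm{Ber}(\rho_{w_i})$, $i=1,\dots,p$, are independent noise random variables, also independent of $\mathbf{X}(t)$ for any $t<k+1$, and the entries of $\mathbf{X}(k+1)$ are conditionally independent Bernoulli random variables given $\mathbf{X}(k)$. The transition probability from $\mathbf{u}$ to $\mathbf{v}$, for $\mathbf{u},\mathbf{v}\in\{0,1\}^p$, is $$p_{\mathbf{u}\mathbf{v}}(\theta)=\prod_{i=1}^p\left[\mathbf{a}_i^\top\mathbf{u}+\rho_{w_i}b_i\right]^{v_i}\left[1-\mathbf{a}_i^\top\mathbf{u}-\rho_{w_i}b_i\right]^{1-v_i}.$$ The initial distribution of $\mathbf{X}(0)$ is assumed not to depend on the model parameters. Write $\mathbf{c}=\mathrm{diag}(\mathbf{b})\rho_w$, i.e., $c_i=b_i\rho_{w_i}$. Closed-form estimator from an observed sequence $\{\mathbf{x}(k)\}_{k=0}^{T}$. For $\mathbf{u}\in\{0,1\}^p$ and $r\in[p]$ let $N_{\mathbf{u}}=\sum_{k=0}^{T-1}\mathbb{I}(\mathbf{x}(k)=\mathbf{u})$ and $N_{\mathbf{u},r,1}=\sum_{k=0}^{T-1}\mathbb{I}(\mathbf{x}(k)=\mathbf{u},\,x_r(k+1)=1)$. (i) Define the estimator $\hat{\mathbf{c}}=[\hat c_1,\dots,\hat c_p]^\top$ of $\mathbf{c}$ by $$\hat c_i=\frac{\sum_{k=0}^{T-1}\mathbb{I}(\mathbf{x}(k)=\mathbf{0}_p,\,x_i(k+1)=1)}{\sum_{k=0}^{T-1}\mathbb{I}(\mathbf{x}(k)=\mathbf{0}_p)},\quad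 i=1,\dots,p,$$ assuming that the state $\mathbf{0}_p$ is visited at least once in the time span $\{0,\dots,T-1\}$. Moreover, in the special case where the $\rho_{w_i}$ are equal to one common value for all $i\in[p]$, $\hat{\mathbf{c}}$ can be replaced by $\hat{\mathbf{c}}=\left(\frac1p\sum_{i=1}^p\hat c_i\right)\mathbf{1}_p$. (ii) Suppose that in $\{\mathbf{x}(k)\}_{k=0}^{T-1}$ there are $m$ distinct states $\mathbf{u}_1,\dots,\mathbf{u}_m$ with $p\le m\le 2^p$. Let $\mathbf{U}_m\in\mathbb{R}^{m\times p}$ be the matrix with $k$-th row $\mathbf{u}_k^\top$, $k\in[m]$, and let $\mathbf{y}_{m,r}=[N_{\mathbf{u}_1,r,1}/N_{\mathbf{u}_1},\dots,N_{\mathbf{u}_m,r,1}/N_{\mathbf{u}_m}]^\top$. Whenever $\mathbf{U}_m$ has full column rank, the estimator $\hat{\mathbf{A}}$ of $\mathbf{A}$ is the $p\times p$ matrix with $r$-th row $\hat{\mathbf{a}}_r^\top$, where $$\hat{\mathbf{a}}_r=(\mathbf{U}_m^\top\mathbf{U}_m)^{-1}\mathbf{U}_m^\top(\mathbf{y}_{m,r}-\hat c_r\mathbf{1}_m),\quad \forall r\in[p].$$ (iii) To obtain a valid estimate of the parameter set for any $T\ge1$, let $$\hat\theta=\left[\left(\hat{\mathbf{A}},\ \hat{\mathbf{b}}=\mathbf{1}_p-\hat{\mathbf{A}}\mathbf{1}_p,\ \hat\rho_w=\left(\mathrm{diag}(\mathbf{1}_p-\hat{\mathbf{A}}\mathbf{1}_p)\right)^{-1}\hat{\mathbf{c}}\right)\right]^+,$$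 where $[\cdot]^+$ corresponds to a projection onto the parameter space $\Theta$.
   Formalization: For the averaged form of the estimator of c, the formal theorem assumes that all b_i are equal in addition to all rho_{w_i} being equal; with equal rho_{w_i} but unequal b_i the averaged estimator is not consistent, so the claim as stated is false there. *)

theory Defs
  imports "HOL-Probability.Probability"
begin

text \<open>
  States in \<open>{0,1}\<close>-valued coordinates are represented by \<open>bool ^ 'p\<close>, where the finite type \<open>'p\<close>
  plays the role of the index set of the \<open>p\<close> nodes.
\<close>

definition vec01 :: "bool ^ 'p \<Rightarrow> real ^ 'p" where
  "vec01 u = (\<chi> i. of_bool (u $ i))"

definition zero_state :: "bool ^ 'p" where
  "zero_state = (\<chi> i. False)"

type_synonym 'p bar_param = "(real ^ 'p ^ 'p) \<times> (real ^ 'p) \<times> (real ^ 'p)"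

definition param_space :: "real \<Rightarrow> real \<Rightarrow> real \<Rightarrow> 'p::finite bar_param set" where
  "param_space b_min rho_min rho_max =
    {(A, b, rho). (\<forall>i j. A $ i $ j \<in> {0..1}) \<and> (\<forall>i. b $ i \<in> {0..1}) \<and>
       (\<forall>i. (\<Sum>j\<in>UNIV. A $ i $ j) + b $ i = 1 \<and> b_min \<le> b $ i \<and> rho $ i \<in> {rho_min..rho_max})}"

text \<open>
  A Bernoulli autoregressive process with positive correlations only, together with its noise
  \<open>W k\<close> (used for \<open>k \<ge> 1\<close>).
  The specification \<open>X\<^sub>i(k+1) \<sim> Ber(a\<^sub>i\<^sup>T X(k) + b\<^sub>i W\<^sub>i(k+1))\<close> gives the conditional law of
  \<open>X\<^sub>i(k+1)\<close> given \<open>X(k)\<close> and \<open>W\<^sub>i(k+1)\<close>. Only the independence of the noise over \<open>i\<close> and of each earlier state is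
  required; stronger joint independence (e.g. of the noise over time) is allowed. The distribution of \<open>X 0\<close> is unrestricted.
\<close>

locale bar_process = prob_space M
  for M :: "'a measure"
    and A :: "real ^ 'p::finite ^ 'p" and b rho :: "real ^ 'p"
    and X W :: "nat \<Rightarrow> 'a \<Rightarrow> bool ^ 'p" +
  assumes X_measurable: "\<And>k. X k \<in> measurable M (count_space UNIV)"
    and W_measurable: "\<And>k. W k \<in> measurable M (count_space UNIV)"
    and Markov: "\<And>k x v. prob {\<omega> \<in> space M. \<forall>t\<le>k. X t \<omega> = x t} > 0 \<Longrightarrow>
      \<P>(\<omega> in M. X (Suc k) \<omega> = v \<bar> \<forall>t\<le>k. X t \<omega> = x t) = \<P>(\<omega> in M. X (Suc k) \<omega> = v \<bar> X k \<omega> = x k)"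
    and W_Bernoulli: "\<And>k i. \<P>(\<omega> in M. W (Suc k) \<omega> $ i) = rho $ i"
    and W_indep: "\<And>k. indep_vars (\<lambda>_. count_space UNIV) (\<lambda>i \<omega>. W (Suc k) \<omega> $ i) UNIV"
    and W_indep_X: "\<And>k t. t < Suc k \<Longrightarrow> indep_var (count_space UNIV) (X t) (count_space UNIV) (W (Suc k))"
    and X_Bernoulli: "\<And>k i u z. prob {\<omega> \<in> space M. X k \<omega> = u \<and> W (Suc k) \<omega> $ i = z} > 0 \<Longrightarrow>
      \<P>(\<omega> in M. X (Suc k) \<omega> $ i \<bar> X k \<omega> = u \<and> W (Suc k) \<omega> $ i = z)
        = A $ i \<bullet> vec01 u + b $ i * of_bool z"
    and X_cond_indep: "\<And>k u v. prob {\<omega> \<in> space M. X k \<omega> = u} > 0 \<Longrightarrow>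
      \<P>(\<omega> in M. X (Suc k) \<omega> = v \<bar> X k \<omega> = u)
        = (\<Prod>i\<in>UNIV. \<P>(\<omega> in M. X (Suc k) \<omega> $ i = v $ i \<bar> X k \<omega> = u))"

definition transition :: "real ^ 'p::finite ^ 'p \<Rightarrow> real ^ 'p \<Rightarrow> real ^ 'p \<Rightarrow> bool ^ 'p \<Rightarrow> bool ^ 'p \<Rightarrow> real" where
  "transition A b rho u v =
    (\<Prod>i\<in>UNIV. (A $ i \<bullet> vec01 u + rho $ i * b $ i) ^ of_bool (v $ i) *
               (1 - A $ i \<bullet> vec01 u - rho $ i * b $ i) ^ of_bool (\<not> v $ i))"

context bar_process
begin

lemma X_marginal:
  assumes "prob {\<omega> \<in> space M. X k \<omega> = u} > 0"
  shows "\<P>(\<omega> in M. X (Suc k) \<omega> $ i \<bar> X k \<omega> = u) = A $ i \<bullet> vec01 u + rho $ i * b $ i"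
proof -
  note [measurable] = X_measurable W_measurable
  define q where "q = prob {\<omega> \<in> space M. X k \<omega> = u}"
  define w where "w z = \<P>(\<omega> in M. W (Suc k) \<omega> $ i = z)" for z
  have q: "q > 0" using assms by (simp add: q_def)
  have w1: "w True = rho $ i" using W_Bernoulli[of k i] by (simp add: w_def)
  have w0: "w False = 1 - rho $ i"
    using prob_neg[of "\<lambda>\<omega>. W (Suc k) \<omega> $ i"] W_Bernoulli[of k i] by (simp add: w_def)
  have XW: "\<P>(\<omega> in M. X k \<omega> = u \<and> W (Suc k) \<omega> $ i = z) = q * w z" for z
  proof -
    from indep_varD[OF W_indep_X, of k k "{u}" "{v. v $ i = z}"] show ?thesis
      by (simp add: q_def w_def vimage_def Int_def conj_commute)
  qed
  have J: "\<P>(\<omega> in M. X (Suc k) \<omega> $ i \<and> X k \<omega> = u \<and> W (Suc k) \<omega> $ i = z)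
      = q * w z * (A $ i \<bullet> vec01 u + b $ i * of_bool z)" for z
  proof (cases "w z > 0")
    case True
    then have "prob {\<omega> \<in> space M. X k \<omega> = u \<and> W (Suc k) \<omega> $ i = z} > 0"
      using q XW[of z] by simp
    from X_Bernoulli[OF this] show ?thesis using True q
      by (simp add: cond_prob_def XW field_simps)
  next
    case False
    then have z: "w z = 0" by (simp add: w_def zero_less_measure_iff)
    have "\<P>(\<omega> in M. X (Suc k) \<omega> $ i \<and> X k \<omega> = u \<and> W (Suc k) \<omega> $ i = z)
       \<le> \<P>(\<omega> in M. X k \<omega> = u \<and> W (Suc k) \<omega> $ i = z)"
      by (rule finite_measure_mono) auto
    with XW[of z] z show ?thesis by (simp add: measure_le_0_iff)
  qed
  have "\<P>(\<omega> in M. X (Suc k) \<omega> $ i \<and> X k \<omega> = u)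
     = \<P>(\<omega> in M. X (Suc k) \<omega> $ i \<and> X k \<omega> = u \<and> W (Suc k) \<omega> $ i = True)
     + \<P>(\<omega> in M. X (Suc k) \<omega> $ i \<and> X k \<omega> = u \<and> W (Suc k) \<omega> $ i = False)"
    by (subst finite_measure_Union[symmetric]) (auto intro!: arg_cong[where f = prob])
  also have "\<dots> = q * (A $ i \<bullet> vec01 u + rho $ i * b $ i)"
    unfolding J w0 w1 by (simp add: algebra_simps)
  finally show ?thesis using q by (simp add: cond_prob_def flip: q_def)
qed

lemma transition_prob:
  assumes "prob {\<omega> \<in> space M. X k \<omega> = u} > 0"
  shows "\<P>(\<omega> in M. X (Suc k) \<omega> = v \<bar> X k \<omega> = u) = transition A b rho u v"
proof -
  note [measurable] = X_measurable
  have "\<P>(\<omega> in M. X (Suc k) \<omega> $ i = v $ i \<bar> X k \<omega> = u)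
      = (A $ i \<bullet> vec01 u + rho $ i * b $ i) ^ of_bool (v $ i) *
        (1 - A $ i \<bullet> vec01 u - rho $ i * b $ i) ^ of_bool (\<not> v $ i)" for i
  proof (cases "v $ i")
    case True
    then show ?thesis using X_marginal[OF assms, of i] by simp
  next
    case False
    have "\<P>(\<omega> in M. X k \<omega> = u) = \<P>(\<omega> in M. X (Suc k) \<omega> $ i \<and> X k \<omega> = u)
       + \<P>(\<omega> in M. \<not> X (Suc k) \<omega> $ i \<and> X k \<omega> = u)"
      by (subst finite_measure_Union[symmetric]) (auto intro!: arg_cong[where f = prob])
    with False assms X_marginal[OF assms, of i] show ?thesis
      by (simp add: cond_prob_def field_simps)
  qed
  then show ?thesis unfolding X_cond_indep[OF assms] transition_def by simp
qed

end

definition visits :: "(nat \<Rightarrow> bool ^ 'p) \<Rightarrow> nat \<Rightarrow> bool ^ 'p \<Rightarrow> real" where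
  "visits x T u = (\<Sum>k<T. of_bool (x k = u))"

definition visits1 :: "(nat \<Rightarrow> bool ^ 'p) \<Rightarrow> nat \<Rightarrow> bool ^ 'p \<Rightarrow> 'p \<Rightarrow> real" where
  "visits1 x T u r = (\<Sum>k<T. of_bool (x k = u \<and> x (Suc k) $ r))"

definition c_hat :: "(nat \<Rightarrow> bool ^ 'p) \<Rightarrow> nat \<Rightarrow> real ^ 'p" where
  "c_hat x T = (\<chi> i. visits1 x T zero_state i / visits x T zero_state)"

text \<open>
  The averaged estimate tends to the mean of the entries \<open>b\<^sub>i rho\<^sub>i\<close> in every coordinate. So it is
  consistent for \<open>diag(b) rho\<close> only if these entries coincide, which a common value of the
  \<open>rho\<^sub>i\<close> does not give by itself: the \<open>b\<^sub>i\<close> have to be equal too.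
\<close>

definition c_hat_avg :: "(nat \<Rightarrow> bool ^ 'p::finite) \<Rightarrow> nat \<Rightarrow> real ^ 'p" where
  "c_hat_avg x T = (\<chi> i. (\<Sum>j\<in>UNIV. c_hat x T $ j) / real CARD('p))"

text \<open>
  The number \<open>m\<close> of distinct observed states depends on the data, so the rows of \<open>U\<^sub>m\<close> are
  labelled by the elements of the finite set \<open>S = {u\<^sub>1, \<dots>, u\<^sub>m}\<close> of these states; the row with label
  \<open>u\<close> is \<open>u\<^sup>T\<close>. Then \<open>gram S\<close> is \<open>U\<^sub>m\<^sup>T U\<^sub>m\<close>, \<open>design_transpose S y\<close> is \<open>U\<^sub>m\<^sup>T y\<close>, and neither depends on
  the enumeration of the states.
\<close>

definition gram :: "(bool ^ 'p) set \<Rightarrow> real ^ 'p ^ 'p" where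
  "gram S = (\<chi> i j. \<Sum>u\<in>S. vec01 u $ i * vec01 u $ j)"

definition design_transpose :: "(bool ^ 'p) set \<Rightarrow> (bool ^ 'p \<Rightarrow> real) \<Rightarrow> real ^ 'p" where
  "design_transpose S y = (\<chi> j. \<Sum>u\<in>S. vec01 u $ j * y u)"

definition A_hat :: "(nat \<Rightarrow> bool ^ 'p::finite) \<Rightarrow> nat \<Rightarrow> real ^ 'p \<Rightarrow> real ^ 'p ^ 'p" where
  "A_hat x T c =
    (let S = x ` {..<T} in
     \<chi> r. matrix_inv (gram S) *v design_transpose S (\<lambda>u. visits1 x T u r / visits x T u - c $ r))"

text \<open>
  The projection onto the parameter space is the Euclidean one. The formulas below are meaningful
  when the zero state has been visited, \<open>U\<^sub>m\<close> has full column rank (i.e. \<open>gram S\<close> is invertible) and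
  no entry of \<open>b\<close> is zero; otherwise they take the default values of division by zero and of the
  inverse of a singular matrix. The argument \<open>c\<close> is the estimate of \<open>diag(b) rho\<close> in use.
\<close>

definition theta_hat ::
  "real \<Rightarrow> real \<Rightarrow> real \<Rightarrow> (nat \<Rightarrow> bool ^ 'p::finite) \<Rightarrow> nat \<Rightarrow> real ^ 'p \<Rightarrow> 'p bar_param" where
  "theta_hat b_min rho_min rho_max x T c =
    (let Ah = A_hat x T c;
         bh = 1 - Ah *v 1;
         rhoh = (\<chi> i. c $ i / bh $ i)
     in closest_point (param_space b_min rho_min rho_max) (Ah, bh, rhoh))"

end

theory Submission
  imports Defs "HOL-Library.Discrete_Functions"
begin

text \<open>
  For a set \<open>V\<close> of states with one-step probabilities \<open>\<kappa>\<close>, the innovations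
  \<open>1[X (Suc k) \<in> V] - \<kappa> (X k)\<close>, weighted by a function of \<open>X k\<close>, are bounded and pairwise
  orthogonal, so their averages tend to zero almost surely (second moments along the squares).
  As all transition probabilities are at least some \<open>\<delta> > 0\<close>, this with \<open>V = {v}\<close> shows that every
  state is visited with asymptotic frequency at least \<open>\<delta>\<close>, without any ergodic theory. With
  \<open>V = {v. v $ r}\<close> it then gives the convergence of the conditional frequencies. Eventually all
  states have been seen, so the least squares problem has a fixed invertible Gram matrix, which
  inverts the linear relation between these frequencies and \<open>A\<close>. The projection at most doubles
  the distance to a point of the parameter space.
\<close>

section \<open>Strong law for bounded, pairwise orthogonal sequences\<close>

lemma filterlim_floor_sqrt_at_top: "filterlim floor_sqrt at_top sequentially"
  unfolding filterlim_at_top eventually_sequentially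
  by (metis floor_sqrt_inverse_power2 mono_floor_sqrt')

text \<open>Let \<open>n\<close> be the integer square root of \<open>T\<close>. At most
  \<open>2 * n\<close> terms separate \<open>n\<^sup>2\<close> from \<open>T\<close>, so they
  contribute at most \<open>2 * n * B\<close> to the sum, which is negligible against
  \<open>n\<^sup>2\<close>.\<close>

lemma averages_tendsto_0_if_square_subsequence:
  fixes d :: "nat \<Rightarrow> real"
  assumes bound: "\<And>k. \<bar>d k\<bar> \<le> B"
    and squares: "(\<lambda>n. (\<Sum>k<n\<^sup>2. d k) / real (n\<^sup>2)) \<longlonglongrightarrow> 0"
  shows "(\<lambda>T. (\<Sum>k<T. d k) / real T) \<longlonglongrightarrow> 0"
proof (rule Lim_null_comparison)
  let ?s = "\<lambda>T. \<Sum>k<T. d k" and ?n = "floor_sqrt"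
  have B: "0 \<le> B" using bound[of 0] by linarith
  show "\<forall>\<^sub>F T in sequentially.
      norm (?s T / real T) \<le> \<bar>?s ((?n T)\<^sup>2) / real ((?n T)\<^sup>2)\<bar> + 2 * B / real (?n T)"
    using eventually_gt_at_top[of 0]
  proof eventually_elim
    case (elim T)
    define n where "n = ?n T"
    have n: "0 < n" using elim by (simp add: n_def)
    have le: "n\<^sup>2 \<le> T" by (simp add: n_def)
    have lt: "T < (Suc n)\<^sup>2" unfolding n_def by (rule Suc_floor_sqrt_power2_gt)
    have len: "real (T - n\<^sup>2) \<le> 2 * real n"
      using lt le by (simp add: power2_eq_square flip: of_nat_mult of_nat_add)
    have "?s T = ?s (n\<^sup>2) + (\<Sum>k\<in>{n\<^sup>2..<T}. d k)"
      using sum.atLeastLessThan_concat[of 0 "n\<^sup>2" T d] le by (simp add: lessThan_atLeast0)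
    moreover have "\<bar>\<Sum>k\<in>{n\<^sup>2..<T}. d k\<bar> \<le> real (T - n\<^sup>2) * B"
      using sum_norm_bound[of "{n\<^sup>2..<T}" d B] bound by simp
    moreover have "real (T - n\<^sup>2) * B \<le> 2 * real n * B"
      using len B by (rule mult_right_mono)
    ultimately have "\<bar>?s T\<bar> \<le> \<bar>?s (n\<^sup>2)\<bar> + 2 * real n * B" by linarith
    then have "\<bar>?s T\<bar> / real T \<le> (\<bar>?s (n\<^sup>2)\<bar> + 2 * real n * B) / real (n\<^sup>2)"
      using le n B by (intro frac_le) (auto simp del: of_nat_power)
    also have "\<dots> = \<bar>?s (n\<^sup>2) / real (n\<^sup>2)\<bar> + 2 * B / real n"
      using n by (simp add: field_simps power2_eq_square)
    finally show ?case by (simp add: n_def)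
  qed
  have "(\<lambda>n. \<bar>?s (n\<^sup>2) / real (n\<^sup>2)\<bar> + 2 * B / real n) \<longlonglongrightarrow> 0"
    using tendsto_add[OF tendsto_rabs_zero[OF squares] lim_const_over_n[of "2 * B"]] by simp
  from filterlim_compose[OF this filterlim_floor_sqrt_at_top]
  show "(\<lambda>T. \<bar>?s ((?n T)\<^sup>2) / real ((?n T)\<^sup>2)\<bar> + 2 * B / real (?n T)) \<longlonglongrightarrow> 0" .
qed

text \<open>
  The squared averages along the squares have summable expectations, so they are almost surely
  summable and tend to zero.
\<close>

lemma (in prob_space) orthogonal_bounded_averages_tendsto_0:
  fixes D :: "nat \<Rightarrow> 'a \<Rightarrow> real"
  assumes meas [measurable]: "\<And>k. D k \<in> borel_measurable M"
    and bound: "\<And>k \<omega>. \<bar>D k \<omega>\<bar> \<le> B"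
    and orth: "\<And>j k. j < k \<Longrightarrow> expectation (\<lambda>\<omega>. D j \<omega> * D k \<omega>) = 0"
  shows "AE \<omega> in M. (\<lambda>T. (\<Sum>k<T. D k \<omega>) / real T) \<longlonglongrightarrow> 0"
proof -
  define S where "S T \<omega> = (\<Sum>k<T. D k \<omega>)" for T \<omega>
  have [measurable]: "S T \<in> borel_measurable M" for T unfolding S_def by measurable
  have B: "0 \<le> B" using bound[of 0 undefined] by linarith
  have S_bound: "\<bar>S T \<omega>\<bar> \<le> real T * B" for T \<omega>
    unfolding S_def using sum_norm_bound[of "{..<T}" "\<lambda>k. D k \<omega>" B] bound by simp
  have int_DD: "integrable M (\<lambda>\<omega>. D j \<omega> * D k \<omega>)" for j k
    by (rule integrable_const_bound[where B = "B * B"])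
       (auto simp: abs_mult intro!: AE_I2 mult_mono bound B)
  have int_SS: "integrable M (\<lambda>\<omega>. (S T \<omega>)\<^sup>2)" for T
    by (rule integrable_const_bound[where B = "(real T * B) * (real T * B)"])
       (auto simp: power2_eq_square abs_mult B simp del: abs_mult_self_eq intro!: AE_I2 mult_mono[OF S_bound S_bound])
  \<comment> \<open>Orthogonality removes the cross terms, so each new term adds at most
    \<open>B\<^sup>2\<close>.\<close>
  have second_moment: "expectation (\<lambda>\<omega>. (S T \<omega>)\<^sup>2) \<le> real T * B\<^sup>2" for T
  proof (induction T)
    case 0
    then show ?case by (simp add: S_def)
  next
    case (Suc T)
    have eq: "(S (Suc T) \<omega>)\<^sup>2 = (S T \<omega>)\<^sup>2 + 2 * (\<Sum>j<T. D j \<omega> * D T \<omega>) + D T \<omega> * D T \<omega>" for \<omega>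
      by (simp add: S_def power2_eq_square algebra_simps sum_distrib_left sum_distrib_right)
    have cross: "expectation (\<lambda>\<omega>. \<Sum>j<T. D j \<omega> * D T \<omega>) = 0"
      using orth int_DD by (subst Bochner_Integration.integral_sum) auto
    have "expectation (\<lambda>\<omega>. D T \<omega> * D T \<omega>) \<le> expectation (\<lambda>\<omega>. B\<^sup>2)"
      using int_DD
      by (intro integral_mono) (auto simp: power2_eq_square intro!: abs_le_square_iff[THEN iffD1, unfolded power2_eq_square] order_trans[OF bound] B)
    then have "expectation (\<lambda>\<omega>. D T \<omega> * D T \<omega>) \<le> B\<^sup>2" by (simp add: prob_space)
    then show ?case
      unfolding eq using Suc.IH cross int_SS int_DD by (simp add: algebra_simps)
  qed
  define Q where "Q n \<omega> = (S (n\<^sup>2) \<omega> / real (n\<^sup>2))\<^sup>2" for n \<omega>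
  have [measurable]: "Q n \<in> borel_measurable M" for n unfolding Q_def by measurable
  \<comment> \<open>Linear growth of the second moment gives \<open>B\<^sup>2 / T\<close> for the
    squared average at time \<open>T\<close>. This bound is not summable over all \<open>T\<close>,
    but it is along \<open>T = n\<^sup>2\<close>. At \<open>n = 0\<close> division by zero makes
    both sides zero.\<close>
  have Q_integral: "(\<integral>\<^sup>+\<omega>. ennreal (Q n \<omega>) \<partial>M) \<le> ennreal (B\<^sup>2 * (1 / real n ^ 2))" for n
  proof -
    have "(\<integral>\<^sup>+\<omega>. ennreal (Q n \<omega>) \<partial>M) = ennreal (expectation (Q n))"
      unfolding Q_def power_divide using int_SS by (intro nn_integral_eq_integral) auto
    also have "expectation (Q n) = expectation (\<lambda>\<omega>. (S (n\<^sup>2) \<omega>)\<^sup>2) / (real (n\<^sup>2))\<^sup>2"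
      unfolding Q_def power_divide by simp
    also have "\<dots> \<le> (real (n\<^sup>2) * B\<^sup>2) / (real (n\<^sup>2))\<^sup>2"
      by (intro divide_right_mono second_moment) simp
    also have "\<dots> = B\<^sup>2 * (1 / real n ^ 2)"
      by (cases "n = 0") (auto simp: field_simps power2_eq_square)
    finally show ?thesis by (simp add: ennreal_leI)
  qed
  have summ: "summable (\<lambda>n. B\<^sup>2 * (1 / real n ^ 2))"
    by (intro summable_mult inverse_power_summable[of 2, where ?'a = real, unfolded inverse_eq_divide]) simp
  have "(\<integral>\<^sup>+\<omega>. (\<Sum>n. ennreal (Q n \<omega>)) \<partial>M) = (\<Sum>n. \<integral>\<^sup>+\<omega>. ennreal (Q n \<omega>) \<partial>M)"
    by (rule nn_integral_suminf) measurable
  also have "\<dots> \<le> (\<Sum>n. ennreal (B\<^sup>2 * (1 / real n ^ 2)))"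
    by (intro suminf_le Q_integral) auto
  also have "\<dots> < \<infinity>" using summ by (subst suminf_ennreal2) auto
  finally have "AE \<omega> in M. (\<Sum>n. ennreal (Q n \<omega>)) \<noteq> \<infinity>"
    by (intro nn_integral_PInf_AE) auto
  then show ?thesis
  proof eventually_elim
    case (elim \<omega>)
    have "summable (\<lambda>n. Q n \<omega>)"
      using elim by (intro summable_suminf_not_top) (auto simp: Q_def)
    then have "(\<lambda>n. Q n \<omega>) \<longlonglongrightarrow> 0" by (rule summable_LIMSEQ_zero)
    \<comment> \<open>The square root of \<open>Q n \<omega>\<close> is the absolute value of the
      average.\<close>
    then have "(\<lambda>n. S (n\<^sup>2) \<omega> / real (n\<^sup>2)) \<longlonglongrightarrow> 0"
      unfolding Q_def using tendsto_real_sqrt[of _ 0] by (fastforce simp: tendsto_rabs_zero_iff)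
    then show ?case
      unfolding S_def by (intro averages_tendsto_0_if_square_subsequence[where B = B] bound)
  qed
qed

section \<open>Innovations of the chain\<close>

context bar_process
begin

lemma history_event [measurable]: "{\<omega> \<in> space M. \<forall>t\<le>k. X t \<omega> = x t} \<in> events"
proof -
  note [measurable] = X_measurable
  show ?thesis by measurable
qed

lemma cond_prob_next_state_in:
  assumes Q [measurable]: "{\<omega> \<in> space M. Q \<omega>} \<in> events"
  shows "\<P>(\<omega> in M. X (Suc k) \<omega> \<in> V \<bar> Q \<omega>) = (\<Sum>v\<in>V. \<P>(\<omega> in M. X (Suc k) \<omega> = v \<bar> Q \<omega>))"
proof -
  note [measurable] = X_measurable
  have "prob {\<omega> \<in> space M. X (Suc k) \<omega> \<in> V \<and> Q \<omega>}
      = prob (\<Union>v\<in>V. {\<omega> \<in> space M. X (Suc k) \<omega> = v \<and> Q \<omega>})"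
    by (rule arg_cong[where f = prob]) auto
  also have "\<dots> = (\<Sum>v\<in>V. prob {\<omega> \<in> space M. X (Suc k) \<omega> = v \<and> Q \<omega>})"
    by (rule finite_measure_finite_Union) (auto simp: disjoint_family_on_def)
  finally show ?thesis by (simp add: cond_prob_def sum_divide_distrib)
qed

text \<open>The Markov assumption concerns single next states; additivity over the finite set
  \<open>V\<close> extends it to events.\<close>

lemma Markov_set:
  assumes "prob {\<omega> \<in> space M. \<forall>t\<le>k. X t \<omega> = x t} > 0"
  shows "\<P>(\<omega> in M. X (Suc k) \<omega> \<in> V \<bar> \<forall>t\<le>k. X t \<omega> = x t) = \<P>(\<omega> in M. X (Suc k) \<omega> \<in> V \<bar> X k \<omega> = x k)"
proof -
  note [measurable] = X_measurable
  show ?thesis by (simp add: cond_prob_next_state_in Markov[OF assms])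
qed

text \<open>The martingale difference property in elementary form. There are finitely many histories
  up to time \<open>k\<close>; on each of them \<open>G\<close> and \<open>\<kappa> (X k)\<close>
  are constant, and by the Markov property the chain enters \<open>V\<close> next with conditional
  probability \<open>\<kappa> (X k)\<close>.\<close>

lemma expectation_history_times_innovation:
  fixes G :: "(nat \<Rightarrow> bool ^ 'p) \<Rightarrow> real"
  assumes \<kappa>: "\<And>u. prob {\<omega> \<in> space M. X k \<omega> = u} > 0 \<Longrightarrow> \<P>(\<omega> in M. X (Suc k) \<omega> \<in> V \<bar> X k \<omega> = u) = \<kappa> u"
    and local: "\<And>x y. (\<forall>t\<le>k. x t = y t) \<Longrightarrow> G x = G y"
  shows "expectation (\<lambda>\<omega>. G (\<lambda>t. X t \<omega>) * (of_bool (X (Suc k) \<omega> \<in> V) - \<kappa> (X k \<omega>))) = 0"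
proof -
  note [measurable] = X_measurable
  \<comment> \<open>Extensional functions make the set of histories finite, and two different
    members differ at some time \<open>t \<le> k\<close>. Hence exactly one history in
    \<open>F\<close> matches a given \<omega>.\<close>
  define F :: "(nat \<Rightarrow> bool ^ 'p) set" where "F = PiE {..k} (\<lambda>_. UNIV)"
  define H where "H x = {\<omega> \<in> space M. \<forall>t\<le>k. X t \<omega> = x t}" for x
  define N where "N x = {\<omega> \<in> space M. X (Suc k) \<omega> \<in> V \<and> (\<forall>t\<le>k. X t \<omega> = x t)}" for x
  have [measurable]: "H x \<in> events" "N x \<in> events" for x unfolding H_def N_def by measurable
  have F: "finite F" unfolding F_def by (intro finite_PiE) auto
  have decomp: "G (\<lambda>t. X t \<omega>) * (of_bool (X (Suc k) \<omega> \<in> V) - \<kappa> (X k \<omega>))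
      = (\<Sum>x\<in>F. G x * (indicator (N x) \<omega> - \<kappa> (x k) * indicator (H x) \<omega>))"
    if "\<omega> \<in> space M" for \<omega>
  proof -
    define y where "y = restrict (\<lambda>t. X t \<omega>) {..k}"
    have y: "y \<in> F" "\<forall>t\<le>k. X t \<omega> = y t" by (auto simp: y_def F_def)
    have other: "\<omega> \<notin> H x \<and> \<omega> \<notin> N x" if "x \<in> F - {y}" for x
    proof -
      have "\<exists>t\<le>k. x t \<noteq> y t"
        using that y(1) PiE_ext[of x "{..k}" "\<lambda>_. UNIV" y] by (auto simp: F_def)
      with y(2) show ?thesis by (auto simp: H_def N_def)
    qed
    have "(\<Sum>x\<in>F. G x * (indicator (N x) \<omega> - \<kappa> (x k) * indicator (H x) \<omega>))
        = G y * (indicator (N y) \<omega> - \<kappa> (y k) * indicator (H y) \<omega>)"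
      using F y(1) other by (subst sum.remove[of _ y]) (auto intro!: sum.neutral)
    also have "\<dots> = G (\<lambda>t. X t \<omega>) * (of_bool (X (Suc k) \<omega> \<in> V) - \<kappa> (X k \<omega>))"
      using y(2) that local[of "\<lambda>t. X t \<omega>" y] by (auto simp: H_def N_def indicator_def)
    finally show ?thesis by simp
  qed
  \<comment> \<open>Nothing is known about \<kappa> at states of probability zero, but there the
    history is a null event and both sides vanish.\<close>
  have cancel: "prob (N x) = \<kappa> (x k) * prob (H x)" for x
  proof (cases "prob (H x) > 0")
    case True
    have "prob (H x) \<le> prob {\<omega> \<in> space M. X k \<omega> = x k}"
      by (rule finite_measure_mono) (auto simp: H_def)
    with True have "prob {\<omega> \<in> space M. X k \<omega> = x k} > 0" by linarith
    with True have "\<P>(\<omega> in M. X (Suc k) \<omega> \<in> V \<bar> \<forall>t\<le>k. X t \<omega> = x t) = \<kappa> (x k)"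
      using Markov_set[of k x V] \<kappa> by (simp add: H_def)
    with True show ?thesis by (simp add: cond_prob_def H_def N_def field_simps)
  next
    case False
    then have "prob (H x) = 0" by (simp add: zero_less_measure_iff)
    moreover have "prob (N x) \<le> prob (H x)"
      by (rule finite_measure_mono) (auto simp: H_def N_def)
    ultimately show ?thesis by (simp add: measure_le_0_iff)
  qed
  have "expectation (\<lambda>\<omega>. G (\<lambda>t. X t \<omega>) * (of_bool (X (Suc k) \<omega> \<in> V) - \<kappa> (X k \<omega>)))
      = expectation (\<lambda>\<omega>. \<Sum>x\<in>F. G x * (indicator (N x) \<omega> - \<kappa> (x k) * indicator (H x) \<omega>))"
    by (intro Bochner_Integration.integral_cong refl decomp)
  also have "\<dots> = (\<Sum>x\<in>F. G x * (prob (N x) - \<kappa> (x k) * prob (H x)))"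
    by (subst Bochner_Integration.integral_sum) (auto simp: emeasure_eq_measure)
  also have "\<dots> = 0" by (simp add: cancel)
  finally show ?thesis .
qed

text \<open>A single \<kappa> serves all times, by homogeneity of the chain. The weight
  \<open>f\<close> later restricts the sum to visits of one state.\<close>

lemma averaged_innovations_tendsto_0:
  fixes f \<kappa> :: "bool ^ 'p \<Rightarrow> real"
  assumes \<kappa>: "\<And>k u. prob {\<omega> \<in> space M. X k \<omega> = u} > 0 \<Longrightarrow> \<P>(\<omega> in M. X (Suc k) \<omega> \<in> V \<bar> X k \<omega> = u) = \<kappa> u"
  shows "AE \<omega> in M. (\<lambda>T. (\<Sum>k<T. f (X k \<omega>) * (of_bool (X (Suc k) \<omega> \<in> V) - \<kappa> (X k \<omega>))) / real T) \<longlonglongrightarrow> 0"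
proof (rule orthogonal_bounded_averages_tendsto_0)
  note [measurable] = X_measurable
  let ?d = "\<lambda>u v. f u * (of_bool (v \<in> V) - \<kappa> u)"
  \<comment> \<open>There are only finitely many pairs of states, so the sum over all of them is a
    uniform bound.\<close>
  define B where "B = (\<Sum>(u, v)\<in>UNIV. \<bar>?d u v\<bar>)"
  show "\<bar>?d (X k \<omega>) (X (Suc k) \<omega>)\<bar> \<le> B" for k \<omega>
    unfolding B_def
    using member_le_sum[of "(X k \<omega>, X (Suc k) \<omega>)" UNIV "\<lambda>(u, v). \<bar>?d u v\<bar>"] by auto
  show "(\<lambda>\<omega>. ?d (X k \<omega>) (X (Suc k) \<omega>)) \<in> borel_measurable M" for k
  proof -
    have [measurable]: "(\<lambda>\<omega>. g (X j \<omega>)) \<in> borel_measurable M" for g :: "bool ^ 'p \<Rightarrow> real" and j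
      by (rule measurable_compose[OF X_measurable]) simp
    show ?thesis by measurable
  qed
  fix j k :: nat
  assume "j < k"
  \<comment> \<open>The innovation at time \<open>j\<close> involves \<open>X (Suc j)\<close>, and
    \<open>Suc j \<le> k\<close>. Its product with \<open>f (X k)\<close> is therefore a function of
    the history up to \<open>k\<close>.\<close>
  then have "expectation (\<lambda>\<omega>. (?d (X j \<omega>) (X (Suc j) \<omega>) * f (X k \<omega>)) * (of_bool (X (Suc k) \<omega> \<in> V) - \<kappa> (X k \<omega>))) = 0"
    using expectation_history_times_innovation[where k = k and V = V and \<kappa> = \<kappa>
        and G = "\<lambda>x. ?d (x j) (x (Suc j)) * f (x k)"] \<kappa> by simp
  then show "expectation (\<lambda>\<omega>. ?d (X j \<omega>) (X (Suc j) \<omega>) * ?d (X k \<omega>) (X (Suc k) \<omega>)) = 0"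
    by (simp add: mult.assoc)
qed

end

section \<open>Projection, least squares and convergence of the estimator on one trajectory\<close>

lemma closed_param_space: "closed (param_space b_min rho_min rho_max)"
proof -
  have "param_space b_min rho_min rho_max =
    {z. (\<forall>i j. 0 \<le> fst z $ i $ j \<and> fst z $ i $ j \<le> 1) \<and> (\<forall>i. 0 \<le> fst (snd z) $ i \<and> fst (snd z) $ i \<le> 1) \<and>
       (\<forall>i. (\<Sum>j\<in>UNIV. fst z $ i $ j) + fst (snd z) $ i = 1 \<and> b_min \<le> fst (snd z) $ i \<and>
         rho_min \<le> snd (snd z) $ i \<and> snd (snd z) $ i \<le> rho_max)}"
    by (auto simp: param_space_def)
  also have "closed \<dots>"
    by (intro closed_Collect_conj closed_Collect_all closed_Collect_le closed_Collect_eq continuous_intros)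
  finally show ?thesis .
qed

text \<open>As \<open>z\<close> itself competes for the minimum, the closest point is no farther
  from \<open>f t\<close> than \<open>z\<close> is; the triangle inequality then gives the factor
  2.\<close>

lemma tendsto_closest_point:
  fixes z :: "'a::euclidean_space"
  assumes "closed S" "z \<in> S" "(f \<longlongrightarrow> z) F"
  shows "((\<lambda>t. closest_point S (f t)) \<longlongrightarrow> z) F"
proof -
  have "((\<lambda>t. 2 * dist (f t) z) \<longlongrightarrow> 0) F"
    using assms(3) by (intro tendsto_mult_right_zero) (rule tendsto_dist_iff[THEN iffD1])
  moreover have "dist (closest_point S (f t)) z \<le> 2 * dist (f t) z" for t
    using closest_point_le[OF assms(1,2), of "f t"] dist_triangle3[of "closest_point S (f t)" z "f t"]
    by simp
  ultimately show ?thesis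
    by (subst tendsto_dist_iff) (rule tendsto_sandwich[OF _ _ tendsto_const], auto)
qed

lemma matrix_inv_left:
  fixes A :: "'a::semiring_1 ^ 'n ^ 'm"
  assumes "invertible A"
  shows "matrix_inv A ** A = mat 1"
  using someI_ex[OF assms[unfolded invertible_def]] unfolding matrix_inv_def by simp

text \<open>These are the normal equations \<open>U\<^sup>T U a = U\<^sup>T (U a)\<close>: least
  squares recovers \<open>a\<close> from exact data whenever the Gram matrix is invertible.\<close>

lemma gram_mult_vec: "gram S *v a = design_transpose S (\<lambda>u. a \<bullet> vec01 u)"
  unfolding gram_def design_transpose_def matrix_vector_mult_def inner_vec_def
  by (auto simp: vec_eq_iff sum_distrib_left sum_distrib_right mult_ac intro: sum.swap)

text \<open>The quadratic form of the Gram matrix is a sum of squares, so a kernel vector is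
  orthogonal to every state, in particular to the unit vectors.\<close>

lemma invertible_gram_UNIV: "invertible (gram (UNIV :: (bool ^ 'p::finite) set))"
proof -
  let ?G = "gram (UNIV :: (bool ^ 'p) set)"
  have "x = 0" if "?G *v x = 0" for x :: "real ^ 'p"
  proof -
    have "(\<Sum>u\<in>UNIV. (x \<bullet> vec01 u)\<^sup>2) = x \<bullet> (?G *v x)"
      unfolding gram_mult_vec design_transpose_def inner_vec_def
      by (simp add: sum_distrib_left sum_distrib_right power2_eq_square mult_ac)
         (subst sum.swap, simp add: sum_distrib_left sum_distrib_right mult_ac)
    then have *: "x \<bullet> vec01 u = 0" for u
      using that by (simp add: sum_nonneg_eq_0_iff)
    have "x $ i = 0" for i
      \<comment> \<open>The state that is true only at \<open>i\<close> represents the unit vector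
        of that coordinate.\<close>
      using *[of "\<chi> j. j = i"] by (simp add: vec01_def inner_vec_def of_bool_def if_distrib cong: if_cong)
    then show ?thesis by (simp add: vec_eq_iff)
  qed
  then show ?thesis
    by (metis matrix_left_invertible_ker invertible_left_inverse)
qed

lemma eventually_all_states_visited:
  assumes "\<And>u. \<forall>\<^sub>F T in sequentially. 0 < visits x T u"
  shows "\<forall>\<^sub>F T in sequentially. x ` {..<T} = (UNIV :: (bool ^ 'p::finite) set)"
proof -
  have "\<forall>\<^sub>F T in sequentially. \<forall>u. 0 < visits x T u"
    using assms by (simp add: eventually_all_finite)
  then show ?thesis
  proof eventually_elim
    case (elim T)
    have "u \<in> x ` {..<T}" for u
    proof (rule ccontr)
      assume "u \<notin> x ` {..<T}"
      then have "visits x T u = 0" by (auto simp: visits_def intro!: sum.neutral)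
      with elim show False by (metis less_irrefl)
    qed
    then show ?case by auto
  qed
qed

text \<open>The deterministic half of the argument. The estimate \<open>c\<close> of
  \<open>diag(b) rho\<close> is left arbitrary so that both the plain and the averaged version
  fit.\<close>

lemma tendsto_theta_hat:
  fixes A :: "real ^ 'p::finite ^ 'p" and b rho :: "real ^ 'p"
  assumes b_min: "0 < b_min"
    and \<theta>: "(A, b, rho) \<in> param_space b_min rho_min rho_max"
    and visited: "\<And>u. \<forall>\<^sub>F T in sequentially. 0 < visits x T u"
    and freq: "\<And>u r. (\<lambda>T. visits1 x T u r / visits x T u) \<longlonglongrightarrow> A $ r \<bullet> vec01 u + rho $ r * b $ r"
    and c: "\<And>r. (\<lambda>T. c T $ r) \<longlonglongrightarrow> rho $ r * b $ r"
  shows "(\<lambda>T. theta_hat b_min rho_min rho_max x T (c T)) \<longlonglongrightarrow> (A, b, rho)"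
proof -
  let ?G = "gram (UNIV :: (bool ^ 'p) set)"
  let ?y = "\<lambda>T r u. visits1 x T u r / visits x T u - c T $ r"
  have "(\<lambda>T. \<chi> r. matrix_inv ?G *v design_transpose UNIV (?y T r)) \<longlonglongrightarrow>
      (\<chi> r. matrix_inv ?G *v design_transpose UNIV (\<lambda>u. A $ r \<bullet> vec01 u))"
  proof (intro tendsto_vec_lambda)
    fix r
    have "(\<lambda>T. ?y T r u) \<longlonglongrightarrow> A $ r \<bullet> vec01 u" for u
      using tendsto_diff[OF freq[of u r] c[of r]] by simp
    then have "(\<lambda>T. design_transpose UNIV (?y T r)) \<longlonglongrightarrow> design_transpose UNIV (\<lambda>u. A $ r \<bullet> vec01 u)"
      unfolding design_transpose_def by (intro tendsto_vec_lambda tendsto_intros)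
    then show "(\<lambda>T. matrix_inv ?G *v design_transpose UNIV (?y T r))
        \<longlonglongrightarrow> matrix_inv ?G *v design_transpose UNIV (\<lambda>u. A $ r \<bullet> vec01 u)"
      by (rule bounded_linear.tendsto[OF matrix_vector_mul_bounded_linear])
  qed
  also have "(\<chi> r. matrix_inv ?G *v design_transpose UNIV (\<lambda>u. A $ r \<bullet> vec01 u)) = A"
    by (simp add: vec_eq_iff matrix_vector_mul_assoc matrix_inv_left[OF invertible_gram_UNIV] flip: gram_mult_vec)
  finally have "(\<lambda>T. \<chi> r. matrix_inv ?G *v design_transpose UNIV (?y T r)) \<longlonglongrightarrow> A" .
  \<comment> \<open>Once every state has occurred, the data-dependent set of observed states in
    \<open>A_hat\<close> is \<open>UNIV\<close>.\<close>
  moreover have "\<forall>\<^sub>F T in sequentially.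
      (\<chi> r. matrix_inv ?G *v design_transpose UNIV (?y T r)) = A_hat x T (c T)"
    using eventually_all_states_visited[OF visited] by eventually_elim (simp add: A_hat_def)
  ultimately have A: "(\<lambda>T. A_hat x T (c T)) \<longlonglongrightarrow> A"
    by (rule Lim_transform_eventually)
  have b_eq: "1 - A *v 1 = b"
    using \<theta> by (auto simp: param_space_def vec_eq_iff matrix_vector_mult_def algebra_simps)
  \<comment> \<open>The lower bound \<open>b_min\<close> keeps the limit of the denominators in the
    estimate of \<open>rho\<close> away from zero.\<close>
  have b_pos: "b $ i \<noteq> 0" for i
    using \<theta> b_min by (auto simp: param_space_def dest: spec[of _ i])
  have "(\<lambda>T. A_hat x T (c T) *v 1) \<longlonglongrightarrow> A *v 1"
    unfolding matrix_vector_mult_def by (intro tendsto_intros A tendsto_vec_lambda)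
  from tendsto_diff[OF tendsto_const[of 1] this]
  have b: "(\<lambda>T. 1 - A_hat x T (c T) *v 1) \<longlonglongrightarrow> b" unfolding b_eq .
  have "(\<lambda>T. \<chi> i. c T $ i / (1 - A_hat x T (c T) *v 1) $ i) \<longlonglongrightarrow> (\<chi> i. rho $ i * b $ i / b $ i)"
    by (intro tendsto_vec_lambda tendsto_divide c tendsto_vec_nth b b_pos)
  also have "(\<chi> i. rho $ i * b $ i / b $ i) = rho" by (simp add: b_pos vec_eq_iff)
  finally show ?thesis
    unfolding theta_hat_def Let_def
    by (intro tendsto_closest_point closed_param_space \<theta> tendsto_Pair A b)
qed

section \<open>Frequencies along one trajectory\<close>

text \<open>The frequency of entering \<open>v\<close> is asymptotically the average of the values
  \<open>\<kappa> (x k)\<close>, each at least \<delta>; half of \<delta> absorbs the error.\<close>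

lemma visit_frequency_lower_bound:
  assumes lower: "\<And>u. \<delta> \<le> \<kappa> u" and \<delta>: "0 < \<delta>"
    and conv: "(\<lambda>T. (\<Sum>k<T. of_bool (x (Suc k) = v) - \<kappa> (x k)) / real T) \<longlonglongrightarrow> 0"
  shows "\<forall>\<^sub>F T in sequentially. \<delta> / 2 \<le> visits x T v / real T"
proof -
  \<comment> \<open>Entries into \<open>v\<close> are counted at times 1 to \<open>T\<close>, visits
    at times 0 to \<open>T - 1\<close>. The term \<open>1 / real T\<close> pays for this
    shift.\<close>
  have "(\<lambda>T. (\<Sum>k<T. of_bool (x (Suc k) = v) - \<kappa> (x k)) / real T - 1 / real T) \<longlonglongrightarrow> 0"
    using tendsto_diff[OF conv lim_const_over_n[of 1]] by simp
  then have "\<forall>\<^sub>F T in sequentially.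
      - (\<delta> / 2) < (\<Sum>k<T. of_bool (x (Suc k) = v) - \<kappa> (x k)) / real T - 1 / real T"
    using \<delta> by (intro order_tendstoD) auto
  then show ?thesis using eventually_gt_at_top[of 0]
  proof eventually_elim
    case (elim T)
    have "visits x (Suc T) v = of_bool (x 0 = v) + (\<Sum>k<T. of_bool (x (Suc k) = v))"
      unfolding visits_def by (rule sum.lessThan_Suc_shift)
    then have "(\<Sum>k<T. of_bool (x (Suc k) = v)) \<le> visits x T v + 1"
      by (auto simp: visits_def of_bool_def split: if_splits)
    moreover have "real T * \<delta> \<le> (\<Sum>k<T. \<kappa> (x k))"
      using sum_bounded_below[of "{..<T}" \<delta> "\<lambda>k. \<kappa> (x k)"] lower by simp
    ultimately have "(\<Sum>k<T. of_bool (x (Suc k) = v) - \<kappa> (x k)) \<le> visits x T v + 1 - real T * \<delta>"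
      by (simp add: sum_subtractf)
    with elim show ?case by (simp add: field_simps)
  qed
qed

text \<open>The error of the conditional frequency is the weighted innovation sum divided by the
  number of visits. As that number is at least \<open>\<delta> * real T\<close>, the error inherits
  the limit zero of the averages.\<close>

lemma conditional_frequency_tendsto:
  assumes \<delta>: "0 < \<delta>" and visits: "\<forall>\<^sub>F T in sequentially. \<delta> \<le> visits x T u / real T"
    and conv: "(\<lambda>T. (\<Sum>k<T. of_bool (x k = u) * (of_bool (x (Suc k) $ r) - \<kappa> (x k))) / real T) \<longlonglongrightarrow> 0"
  shows "(\<lambda>T. visits1 x T u r / visits x T u) \<longlonglongrightarrow> \<kappa> u"
proof -
  define s where "s T = (\<Sum>k<T. of_bool (x k = u) * (of_bool (x (Suc k) $ r) - \<kappa> (x k)))" for T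
  have s: "s T = visits1 x T u r - \<kappa> u * visits x T u" for T
    unfolding s_def visits1_def visits_def sum_distrib_left sum_subtractf[symmetric]
    by (intro sum.cong) auto
  have "(\<lambda>T. visits1 x T u r / visits x T u - \<kappa> u) \<longlonglongrightarrow> 0"
  proof (rule Lim_null_comparison)
    show "(\<lambda>T. \<bar>s T / real T\<bar> / \<delta>) \<longlonglongrightarrow> 0"
      using tendsto_divide[OF tendsto_rabs_zero[OF conv] tendsto_const[of \<delta>]] \<delta> by (simp add: s_def)
    show "\<forall>\<^sub>F T in sequentially. norm (visits1 x T u r / visits x T u - \<kappa> u) \<le> \<bar>s T / real T\<bar> / \<delta>"
      using visits eventually_gt_at_top[of 0]
    proof eventually_elim
      case (elim T)
      then have v: "\<delta> * real T \<le> visits x T u" by (simp add: field_simps)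
      have T: "0 < \<delta> * real T" using elim \<delta> by simp
      have "visits1 x T u r / visits x T u - \<kappa> u = s T / visits x T u"
        using v T by (simp add: s field_simps)
      then have "norm (visits1 x T u r / visits x T u - \<kappa> u) = \<bar>s T\<bar> / visits x T u"
        using v T by simp
      also have "\<dots> \<le> \<bar>s T\<bar> / (\<delta> * real T)" using v T by (intro divide_left_mono) auto
      finally show ?case by (simp add: mult.commute)
    qed
  qed
  then show ?thesis by (simp add: Lim_null[symmetric])
qed

section \<open>Positive transition probabilities and almost sure consistency\<close>

text \<open>Noise acts at every node: \<open>rho $ i * b $ i\<close> is positive, and it is less
  than \<open>b $ i\<close>, which is one minus the row sum of \<open>A\<close>. So both outcomes
  have positive probability at each node, and \<delta> is the minimum over finitely many pairs of
  states.\<close>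

lemma transition_lower_bound:
  fixes A :: "real ^ 'p::finite ^ 'p" and b rho :: "real ^ 'p"
  assumes "0 < b_min" "0 < rho_min" "rho_max < 1"
    and \<theta>: "(A, b, rho) \<in> param_space b_min rho_min rho_max"
  obtains \<delta> where "0 < \<delta>" "\<And>u v. \<delta> \<le> transition A b rho u v"
proof -
  have pos: "0 < transition A b rho u v" for u v
    unfolding transition_def
  proof (intro prod_pos ballI)
    fix i
    have row: "\<And>j. 0 \<le> A $ i $ j" "(\<Sum>j\<in>UNIV. A $ i $ j) + b $ i = 1" "0 < b $ i" "0 < rho $ i" "rho $ i < 1"
      using \<theta> assms by (auto simp: param_space_def dest!: spec[of _ i] intro: less_le_trans le_less_trans)
    have "0 \<le> A $ i \<bullet> vec01 u"
      unfolding inner_vec_def vec01_def using row(1) by (auto intro!: sum_nonneg)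
    moreover have "A $ i \<bullet> vec01 u \<le> (\<Sum>j\<in>UNIV. A $ i $ j)"
      unfolding inner_vec_def vec01_def using row(1) by (auto intro!: sum_mono simp: of_bool_def)
    moreover have "0 < rho $ i * b $ i" using row by simp
    moreover have "rho $ i * b $ i < b $ i" using row by simp
    ultimately show "0 < (A $ i \<bullet> vec01 u + rho $ i * b $ i) ^ of_bool (v $ i) *
        (1 - A $ i \<bullet> vec01 u - rho $ i * b $ i) ^ of_bool (\<not> v $ i)"
      using row(2) by (cases "v $ i") auto
  qed
  define \<delta> where "\<delta> = Min (range (\<lambda>(u, v). transition A b rho u v))"
  show ?thesis
  proof
    show "0 < \<delta>" unfolding \<delta>_def using pos by (subst Min_gr_iff) auto
    show "\<delta> \<le> transition A b rho u v" for u v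
      unfolding \<delta>_def by (rule Min_le) (auto intro: range_eqI[where x = "(u, v)"])
  qed
qed

theorem theorem3:
  fixes M :: "'a measure"
    and A :: "real ^ 'p::finite ^ 'p" and b rho :: "real ^ 'p"
    and X W :: "nat \<Rightarrow> 'a \<Rightarrow> bool ^ 'p"
    and b_min rho_min rho_max :: real
  assumes "0 < b_min" "b_min < 1"
    and "0 < rho_min" "rho_min < rho_max" "rho_max < 1"
    and "(A, b, rho) \<in> param_space b_min rho_min rho_max"
    and "bar_process M A b rho X W"
  shows "(AE \<omega> in M.
            (\<lambda>T. theta_hat b_min rho_min rho_max (\<lambda>k. X k \<omega>) T (c_hat (\<lambda>k. X k \<omega>) T))
              \<longlonglongrightarrow> (A, b, rho)) \<and>
         ((\<forall>i j. rho $ i = rho $ j) \<and> (\<forall>i j. b $ i = b $ j) \<longrightarrow>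
          (AE \<omega> in M.
            (\<lambda>T. theta_hat b_min rho_min rho_max (\<lambda>k. X k \<omega>) T (c_hat_avg (\<lambda>k. X k \<omega>) T))
              \<longlonglongrightarrow> (A, b, rho)))"
proof -
  interpret bar_process M A b rho X W by fact
  obtain \<delta> where \<delta>: "0 < \<delta>" "\<And>u v. \<delta> \<le> transition A b rho u v"
    using transition_lower_bound assms by metis
  let ?x = "\<lambda>\<omega> k. X k \<omega>"
  let ?q = "\<lambda>r u. A $ r \<bullet> vec01 u + rho $ r * b $ r"
  \<comment> \<open>These are the conditions on a trajectory from which consistency follows
    deterministically. They range over finitely many states and nodes, so one null set covers all of
    them.\<close>
  define good where "good x \<longleftrightarrow> (\<forall>u. \<forall>\<^sub>F T in sequentially. 0 < visits x T u) \<and>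
    (\<forall>u r. (\<lambda>T. visits1 x T u r / visits x T u) \<longlonglongrightarrow> ?q r u)" for x
  have "AE \<omega> in M. \<forall>v. (\<lambda>T. (\<Sum>k<T. of_bool (X (Suc k) \<omega> = v) - transition A b rho (X k \<omega>) v) / real T) \<longlonglongrightarrow> 0"
    using averaged_innovations_tendsto_0[where f = "\<lambda>_. 1" and V = "{v}" and \<kappa> = "\<lambda>u. transition A b rho u v" for v]
    by (simp add: AE_all_countable transition_prob)
  moreover have "AE \<omega> in M. \<forall>u r. (\<lambda>T. (\<Sum>k<T. of_bool (X k \<omega> = u) *
      (of_bool (X (Suc k) \<omega> $ r) - ?q r (X k \<omega>))) / real T) \<longlonglongrightarrow> 0"
    using averaged_innovations_tendsto_0[where f = "\<lambda>w. of_bool (w = u)" and V = "{v. v $ r}" and \<kappa> = "?q r" for u r]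
    by (simp add: AE_all_countable X_marginal)
  ultimately have good: "AE \<omega> in M. good (?x \<omega>)"
  proof eventually_elim
    case (elim \<omega>)
    have low: "\<forall>\<^sub>F T in sequentially. \<delta> / 2 \<le> visits (?x \<omega>) T v / real T" for v
      by (rule visit_frequency_lower_bound[where \<kappa> = "\<lambda>u. transition A b rho u v"])
         (use \<delta> elim(1) in auto)
    have "\<forall>\<^sub>F T in sequentially. 0 < visits (?x \<omega>) T v" for v
      using low[of v] eventually_gt_at_top[of 0]
    proof eventually_elim
      case (elim T)
      then have "0 < visits (?x \<omega>) T v / real T" using \<delta>(1) by linarith
      with elim show ?case by (simp add: zero_less_divide_iff)
    qed
    moreover have "(\<lambda>T. visits1 (?x \<omega>) T u r / visits (?x \<omega>) T u) \<longlonglongrightarrow> ?q r u" for u r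
      using conditional_frequency_tendsto[OF _ low, of u r "?q r"] \<delta>(1) elim(2) by simp
    ultimately show ?case by (simp add: good_def)
  qed
  have c: "(\<lambda>T. c_hat x T $ r) \<longlonglongrightarrow> rho $ r * b $ r" if "good x" for x r
  proof -
    \<comment> \<open>At the zero state the autoregressive term vanishes, so the conditional
      frequency isolates \<open>rho $ r * b $ r\<close>.\<close>
    have zero: "vec01 (zero_state :: bool ^ 'p) = 0"
      by (simp add: vec01_def zero_state_def vec_eq_iff)
    from that have "(\<lambda>T. visits1 x T zero_state r / visits x T zero_state) \<longlonglongrightarrow> ?q r zero_state"
      unfolding good_def by blast
    then show ?thesis by (simp add: c_hat_def zero)
  qed
  have consistent: "(\<lambda>T. theta_hat b_min rho_min rho_max x T (d T)) \<longlonglongrightarrow> (A, b, rho)"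
    if "good x" "\<And>r. (\<lambda>T. d T $ r) \<longlonglongrightarrow> rho $ r * b $ r" for x d
    using tendsto_theta_hat[of b_min A b rho rho_min rho_max x d] assms that unfolding good_def by blast
  have "AE \<omega> in M. (\<lambda>T. theta_hat b_min rho_min rho_max (?x \<omega>) T (c_hat (?x \<omega>) T)) \<longlonglongrightarrow> (A, b, rho)"
    using good by eventually_elim (intro consistent c)
  moreover have "AE \<omega> in M. (\<lambda>T. theta_hat b_min rho_min rho_max (?x \<omega>) T (c_hat_avg (?x \<omega>) T)) \<longlonglongrightarrow> (A, b, rho)"
    if eq: "\<forall>i j. rho $ i = rho $ j" "\<forall>i j. b $ i = b $ j"
    using good
  proof eventually_elim
    case (elim \<omega>)
    have "(\<lambda>T. c_hat_avg (?x \<omega>) T $ r) \<longlonglongrightarrow> rho $ r * b $ r" for r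
    proof -
      have "(\<lambda>T. (\<Sum>j\<in>UNIV. c_hat (?x \<omega>) T $ j) / real CARD('p)) \<longlonglongrightarrow> (\<Sum>j\<in>UNIV. rho $ j * b $ j) / real CARD('p)"
        by (intro tendsto_intros c elim) simp
      \<comment> \<open>With \<open>rho\<close> and \<open>b\<close> both constant over the nodes,
        the mean of the products equals each of them.\<close>
      moreover have "(\<Sum>j\<in>UNIV. rho $ j * b $ j) = (\<Sum>j\<in>(UNIV :: 'p set). rho $ r * b $ r)"
        using eq by (intro sum.cong refl) metis
      ultimately show ?thesis by (simp add: c_hat_avg_def)
    qed
    then show ?case by (intro consistent elim)
  qed
  ultimately show ?thesis by blast
qed

end
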